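(* Let $n$ be a positive integer and let $G$ be a simple graph. If $G$ is $n$-line existentially closed, then $n\leq 2$. Equivalently, $\Xi'(G)\leq 2$ for every simple graph $G$.
   Context: Two distinct edges of a graph are adjacent if they share at least one end vertex. For a positive integer $n$, a graph with at least $n$ edges is $n$-line existentially closed ($n$-line e.c.) if, for all disjoint sets of edges $A$ and $B$ with $|A\cup B|=n$ (either may be empty), there is an edge $e\notin A\cup B$ that is adjacent to each edge of $A$ and to no edge of $B$. (Equivalently, the line graph of $G$ is $n$-existentially closed.) $\Xi'(G)$ denotes the largest positive integer $n$ for which $G$ is $n$-line e.c. (with the convention $\Xi'(G)=0$ if there is no such $n$). *)

theory Defs
  imports Main "HOL-Library.Ramsey"
begin

text \<open>
  A simple graph is given by its vertex set \<open>V\<close> and its edge set \<open>E\<close>, the edges being two-element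
  subsets of \<open>V\<close>; hence there are no loops and no parallel edges. Neither set is required to be finite.
\<close>

definition simple_graph :: "'a set \<Rightarrow> 'a set set \<Rightarrow> bool" where
  "simple_graph V E \<longleftrightarrow> E \<subseteq> nsets V 2"

definition edges_adjacent :: "'a set \<Rightarrow> 'a set \<Rightarrow> bool" where
  "edges_adjacent e f \<longleftrightarrow> e \<noteq> f \<and> e \<inter> f \<noteq> {}"

text \<open>
  The first conjunct says that there are at least \<open>n\<close> edges; the disjunct \<open>infinite E\<close> is needed
  because \<open>card\<close> is \<open>0\<close> on infinite sets. For the same reason \<open>A \<union> B\<close> is required to be finite,
  which matters only for \<open>n = 0\<close>.
\<close>

definition line_ec :: "nat \<Rightarrow> 'a set set \<Rightarrow> bool" where
  "line_ec n E \<longleftrightarrow>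
     (infinite E \<or> n \<le> card E) \<and>
     (\<forall>A B. A \<subseteq> E \<longrightarrow> B \<subseteq> E \<longrightarrow> A \<inter> B = {} \<longrightarrow> finite (A \<union> B) \<longrightarrow> card (A \<union> B) = n \<longrightarrow>
       (\<exists>e\<in>E. e \<notin> A \<union> B \<and> (\<forall>a\<in>A. edges_adjacent e a) \<and> (\<forall>b\<in>B. \<not> edges_adjacent e b)))"

text \<open>
  \<open>GREATEST\<close> is meaningful here only if the positive \<open>n\<close> with \<open>line_ec n E\<close> are bounded, which is
  part of what is to be shown.
\<close>

definition line_ec_number :: "'a set set \<Rightarrow> nat" where
  "line_ec_number E =
     (if \<exists>n>0. line_ec n E then (GREATEST n. n > 0 \<and> line_ec n E) else 0)"

end

theory Submission
  imports Defs
begin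

text \<open>
  If \<open>n \<ge> 3\<close>, applying the property with \<open>A = {}\<close> repeatedly yields three pairwise disjoint edges.
  No edge is adjacent to all three of them, since an edge has only two ends.
\<close>

text \<open>The definition speaks only of exactly \<open>n\<close> edges. A smaller
  \<open>A \<union> B\<close> is reduced to that case by enlarging \<open>B\<close> alone: avoiding
  adjacency with more edges only strengthens the conclusion.\<close>

lemma line_ec_extension:
  assumes ec: "line_ec n E"
    and sub: "A \<subseteq> E" "B \<subseteq> E" and disj: "A \<inter> B = {}"
    and fin: "finite (A \<union> B)" and le: "card (A \<union> B) \<le> n"
  obtains e where "e \<in> E" "e \<notin> A \<union> B"
    "\<forall>a\<in>A. edges_adjacent e a" "\<forall>b\<in>B. \<not> edges_adjacent e b"
proof -
  \<comment> \<open>The padding \<open>D\<close> comes from the edges outside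
    \<open>A \<union> B\<close>. Enough of them remain because \<open>line_ec\<close> requires
    \<open>E\<close> to be infinite or \<open>n \<le> card E\<close>.\<close>
  have "\<exists>D. D \<subseteq> E - (A \<union> B) \<and> finite D \<and> card D = n - card (A \<union> B)"
  proof (cases "finite E")
    case True
    then have "n \<le> card E" using ec by (auto simp: line_ec_def)
    then have "n - card (A \<union> B) \<le> card (E - (A \<union> B))"
      using fin sub by (simp add: card_Diff_subset)
    then show ?thesis by (meson obtain_subset_with_card_n)
  next
    case False
    then have "infinite (E - (A \<union> B))" using fin by simp
    then show ?thesis by (meson infinite_arbitrarily_large)
  qed
  then obtain D where D: "D \<subseteq> E - (A \<union> B)" "finite D" "card D = n - card (A \<union> B)"
    by blast
  have "card ((A \<union> B) \<union> D) = card (A \<union> B) + card D"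
    using D fin by (intro card_Un_disjoint) auto
  then have "card (A \<union> (B \<union> D)) = n" using D le by (simp add: Un_assoc)
  moreover have "finite (A \<union> (B \<union> D))" "B \<union> D \<subseteq> E" "A \<inter> (B \<union> D) = {}"
    using D fin sub disj by auto
  ultimately have "\<exists>e\<in>E. e \<notin> A \<union> (B \<union> D) \<and>
      (\<forall>a\<in>A. edges_adjacent e a) \<and> (\<forall>b\<in>B \<union> D. \<not> edges_adjacent e b)"
    using ec[unfolded line_ec_def, THEN conjunct2, THEN spec[of _ A], THEN spec[of _ "B \<union> D"]] sub(1)
    by argo
  then show thesis using that by blast
qed

text \<open>This is the extension property with \<open>A = {}\<close>. Since
  \<open>edges_adjacent\<close> is false for equal edges, \<open>e \<notin> B\<close> is what turns
  non-adjacency into disjointness.\<close>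

lemma line_ec_disjoint_edge:
  assumes "line_ec n E" "B \<subseteq> E" "finite B" "card B \<le> n"
  obtains e where "e \<in> E" "\<forall>b\<in>B. e \<inter> b = {}"
proof -
  obtain e where "e \<in> E" "e \<notin> B" "\<forall>b\<in>B. \<not> edges_adjacent e b"
    using line_ec_extension[of n E "{}" B] assms by auto
  then show thesis by (intro that) (auto simp: edges_adjacent_def)
qed

lemma line_ec_le_2:
  assumes graph: "simple_graph V E" and ec: "line_ec n E"
  shows "n \<le> 2"
proof (rule ccontr)
  assume "\<not> n \<le> 2"
  then have n: "3 \<le> n" by simp
  obtain e1 where e1: "e1 \<in> E"
    using line_ec_disjoint_edge[OF ec, of "{}"] by auto
  obtain e2 where e2: "e2 \<in> E" "e2 \<inter> e1 = {}"
    using line_ec_disjoint_edge[OF ec, of "{e1}"] e1 n by auto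
  have "{e1, e2} \<subseteq> E" "finite {e1, e2}" "card {e1, e2} \<le> n"
    using e1 e2 n by (simp_all add: card_insert_if)
  from line_ec_disjoint_edge[OF ec this]
  obtain e3 where e3: "e3 \<in> E" "e3 \<inter> e1 = {}" "e3 \<inter> e2 = {}"
    by (metis insertCI)
  \<comment> \<open>Here \<open>3 \<le> n\<close> is used in full: the three edges may all be placed
    on the side \<open>A\<close>, with \<open>B\<close> empty.\<close>
  have "{e1, e2, e3} \<subseteq> E" "{} \<subseteq> E" "{e1, e2, e3} \<inter> {} = {}"
    "finite ({e1, e2, e3} \<union> {})" "card ({e1, e2, e3} \<union> {}) \<le> n"
    using e1 e2 e3 n by (simp_all add: card_insert_if)
  from line_ec_extension[OF ec this]
  obtain f where f: "f \<in> E" "\<forall>a\<in>{e1, e2, e3}. edges_adjacent f a"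
    by metis
  then have "f \<inter> e1 \<noteq> {}" "f \<inter> e2 \<noteq> {}" "f \<inter> e3 \<noteq> {}"
    by (simp_all add: edges_adjacent_def)
  then obtain x y z where xyz: "x \<in> f \<inter> e1" "y \<in> f \<inter> e2" "z \<in> f \<inter> e3"
    by (metis ex_in_conv)
  have "finite f" "card f = 2"
    using f(1) graph by (auto simp: simple_graph_def nsets_def)
  \<comment> \<open>A coincidence would give a common point of two of the pairwise disjoint edges
    \<open>e1\<close>, \<open>e2\<close>, \<open>e3\<close>.\<close>
  moreover have "x \<noteq> y" "x \<noteq> z" "y \<noteq> z"
    using xyz e2(2) e3(2,3) by blast+
  then have "card {x, y, z} = 3" by simp
  moreover have "{x, y, z} \<subseteq> f" using xyz by simp
  ultimately show False using card_mono[of f "{x, y, z}"] by simp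
qed

theorem theorem3:
  fixes V :: "'a set" and E :: "'a set set"
  assumes "simple_graph V E"
  shows "(\<forall>n::nat. n > 0 \<longrightarrow> line_ec n E \<longrightarrow> n \<le> 2) \<and> line_ec_number E \<le> 2"
proof -
  have bound: "n \<le> 2" if "line_ec n E" for n
    using line_ec_le_2[OF assms that] .
  have "line_ec_number E \<le> 2"
  proof (cases "\<exists>n>0. line_ec n E")
    case True
    \<comment> \<open>The admissible \<open>n\<close> exist and are bounded by 2, so the greatest
      one is attained and \<open>bound\<close> applies to it.\<close>
    then have "line_ec (GREATEST n. n > 0 \<and> line_ec n E) E"
      using GreatestI_ex_nat[of "\<lambda>n. n > 0 \<and> line_ec n E" 2] bound by blast
    then show ?thesis using True bound by (simp add: line_ec_number_def)
  next
    case False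
    then show ?thesis by (simp only: line_ec_number_def if_False)
  qed
  then show ?thesis using bound by blast
qed

end
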